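(* Let $M$ be a pointed metric space such that $\mathrm{LipSNA}(M,\mathbb{R})$ is dense in $\mathrm{Lip}_0(M,\mathbb{R})$, let $Y$ be a Banach space having $ACK$ structure with parameter $\rho\in[0,1)$, and let $\Gamma\subseteq B_{Y^*}$ be the associated $1$-norming set (as in the definition of $ACK$ structure). Then $$\mathrm{Fl}_\Gamma(\mathcal{F}(M),Y)\subseteq\overline{\mathrm{LipSNA}(M,Y)}.$$
   Context: All metric spaces are complete and all Banach spaces are real. $B_X$, $S_X$ are the closed unit ball and unit sphere of a Banach space $X$; $L(X,Y)$ is the space of bounded linear operators; $w^*$ is the weak-star topology. A pointed metric space is a metric space $(M,d)$ with a distinguished point $0\in M$. $\mathrm{Lip}_0(M,Y)$ is the Banach space of Lipschitz maps $F\colon M\to Y$ with $F(0)=0$, with norm $\|F\|_L=\sup\{\|F(p)-F(q)\|/d(p,q)\colon p\neq q\}$. $F$ strongly attains its norm if there are $p\neq q$ in $M$ with $\|F(p)-F(q)\|/d(p,q)=\|F\|_L$; $\mathrm{LipSNA}(M,Y)$ is the set of such maps. For $p\in M$ let $\delta(p)\in\mathrm{Lip}_0(M,\mathbb{R})^*$ be $\langle f,\delta(p)\rangle=f(p)$. The Lipschitz-free space is $\mathcal{F}(M)=\overline{\mathrm{span}}\{\delta(p)\colon p\in M\}\subseteq\mathrm{Lip}_0(M,\mathbb{R})^*$. Each $F\in\mathrm{Lip}_0(M,Y)$ corresponds to the unique $\widehat F\in L(\mathcal{F}(M),Y)$ with $\widehat F(\delta(p))=F(p)$; the map $F\mapsto\widehat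 F$ is an isometric isomorphism of $\mathrm{Lip}_0(M,Y)$ onto $L(\mathcal{F}(M),Y)$, and the two spaces are identified through it (the inclusion in the claim is under this identification, and closure is in norm). Let $\Gamma\subseteq Y^*$. An operator $T\in L(X,Y)$ is $\Gamma$-flat if for every $w^*$-open $U\subseteq Y^*$ with $U\cap\Gamma\neq\emptyset$ and every $\varepsilon>0$ there is a $w^*$-open $V\subseteq U$ with $V\cap\Gamma\neq\emptyset$ and $\mathrm{diam}(T^*(V\cap\Gamma))<\varepsilon$ (norm diameter in $X^*$). $\mathrm{Fl}_\Gamma(X,Y)$ is the set of $\Gamma$-flat operators in $L(X,Y)$. A set $\Gamma\subseteq B_{Y^*}$ is $1$-norming if $\|y\|=\sup\{|f(y)|\colon f\in\Gamma\}$ for all $y\in Y$. A Banach space $Y$ has $ACK$ structure with parameter $\rho\in[0,1)$ (written $Y\in ACK_\rho$) if there is a $1$-norming set $\Gamma\subseteq B_{Y^*}$ such that for every $\varepsilon>0$ and every nonempty relatively $w^*$-open $U\subseteq\Gamma$ there exist a nonempty $V\subseteq U$, $y_1^*\in V$, $e\in S_Y$ and $F\in L(Y,Y)$ such that: (1) $\|Fe\|=\|F\|=1$; (2) $y_1^*(Fe)=1$; (3) $F^*y_1^*=y_1^*$; (4) with $V_1=\{y^*\in\Gamma\colon\|F^*y^*\|+(1-\varepsilon)\|(\mathrm{Id}_{Y^*}-F^* )(y^* )\|\leq1\}$, one has $|v^*(Fe)|\leq\rho$ for all $v^*\in\Gamma\setminus V_1$; (5) $d(F^*y^*,\mathrm{aco}\{0,V\})<\varepsilon$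 for every $y^*\in\Gamma$, where $\mathrm{aco}\{0,V\}$ is the absolutely convex hull of $\{0\}\cup V$; (6) $|v^*(e)-1|\leq\varepsilon$ for every $v^*\in V$. *)

theory Defs
  imports "HOL-Analysis.Analysis"
begin

section \<open>Norming functionals\<close>

definition sublinear :: "('b::real_vector \<Rightarrow> real) \<Rightarrow> bool" where
  "sublinear p \<longleftrightarrow> (\<forall>x y. p (x + y) \<le> p x + p y) \<and> (\<forall>c x. 0 \<le> c \<longrightarrow> p (c *\<^sub>R x) \<le> c * p x)"

lemma sublinear_zero: assumes "sublinear p" shows "p 0 = 0"
proof -
  have "p (0 + 0) \<le> p 0 + p 0" "p (0 *\<^sub>R 0) \<le> 0 * p 0"
    using assms unfolding sublinear_def by blast+
  then show ?thesis by simp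
qed

lemma sublinear_scaleR: assumes "sublinear p" "0 \<le> c" shows "p (c *\<^sub>R x) = c * p x"
proof (cases "c = 0")
  case True
  then show ?thesis using sublinear_zero[OF assms(1)] by simp
next
  case False
  have "p (inverse c *\<^sub>R (c *\<^sub>R x)) \<le> inverse c * p (c *\<^sub>R x)" "p (c *\<^sub>R x) \<le> c * p x"
    using assms unfolding sublinear_def by (metis inverse_nonnegative_iff_nonnegative)+
  then show ?thesis using False assms(2) by (simp add: field_simps)
qed

lemma sublinear_neg: assumes "sublinear p" shows "- p (- x) \<le> p x"
proof -
  have "p (x + - x) \<le> p x + p (- x)" using assms unfolding sublinear_def by blast
  then show ?thesis using sublinear_zero[OF assms] by simp
qed

lemma sublinear_shift:
  fixes a :: "'b::real_vector"
  assumes p: "sublinear p"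
    and q_def: "q = (\<lambda>x. INF t\<in>{0::real..}. p (x + t *\<^sub>R a) - t * p a)"
  shows "sublinear q" "q x \<le> p x" "q x \<le> p (x + a) - p a"
proof -
  have add: "p (x + y) \<le> p x + p y" for x y using p unfolding sublinear_def by blast
  have bdd: "bdd_below ((\<lambda>t. p (x + t *\<^sub>R a) - t * p a) ` {0..})" for x
  proof (rule bdd_belowI2[where m = "- p (- x)"])
    fix t :: real assume "t \<in> {0..}"
    moreover have "p ((x + t *\<^sub>R a) + - x) \<le> p (x + t *\<^sub>R a) + p (- x)" by (rule add)
    ultimately show "- p (- x) \<le> p (x + t *\<^sub>R a) - t * p a"
      using sublinear_scaleR[OF p, of t a] by simp
  qed
  have up: "q x \<le> p (x + t *\<^sub>R a) - t * p a" if "0 \<le> t" for x t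
    unfolding q_def by (rule cINF_lower[OF bdd]) (use that in auto)
  have low: "z \<le> q x" if "\<And>t. 0 \<le> t \<Longrightarrow> z \<le> p (x + t *\<^sub>R a) - t * p a" for z x
    unfolding q_def by (rule cINF_greatest) (use that in auto)
  show "q x \<le> p x" using up[of 0 x] by simp
  show "q x \<le> p (x + a) - p a" using up[of 1 x] by simp
  have "q (x + y) \<le> q x + q y" for x y
  proof -
    have "q (x + y) - (p (y + s *\<^sub>R a) - s * p a) \<le> q x" if s: "0 \<le> s" for s
    proof (rule low)
      fix t :: real assume t: "0 \<le> t"
      have "q (x + y) \<le> p ((x + y) + (t + s) *\<^sub>R a) - (t + s) * p a"
        by (rule up) (use s t in auto)
      moreover have "(x + y) + (t + s) *\<^sub>R a = (x + t *\<^sub>R a) + (y + s *\<^sub>R a)"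
        by (simp add: algebra_simps)
      ultimately show "q (x + y) - (p (y + s *\<^sub>R a) - s * p a)
          \<le> p (x + t *\<^sub>R a) - t * p a"
        using add[of "x + t *\<^sub>R a" "y + s *\<^sub>R a"] by (simp add: algebra_simps)
    qed
    then have "q (x + y) - q x \<le> p (y + s *\<^sub>R a) - s * p a" if "0 \<le> s" for s
      using that by fastforce
    then have "q (x + y) - q x \<le> q y" by (rule low)
    then show ?thesis by simp
  qed
  moreover have "q (c *\<^sub>R x) \<le> c * q x" if c: "0 \<le> c" for c x
  proof (cases "c = 0")
    case True
    then show ?thesis using up[of 0 0] sublinear_zero[OF p] by simp
  next
    case False
    then have "q (c *\<^sub>R x) / c \<le> p (x + t *\<^sub>R a) - t * p a" if t: "0 \<le> t" for t
    proof -
      have "q (c *\<^sub>R x) \<le> p (c *\<^sub>R x + (c * t) *\<^sub>R a) - (c * t) * p a"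
        by (rule up) (use c t in auto)
      also have "c *\<^sub>R x + (c * t) *\<^sub>R a = c *\<^sub>R (x + t *\<^sub>R a)" by (simp add: algebra_simps)
      also have "p (c *\<^sub>R (x + t *\<^sub>R a)) - (c * t) * p a = c * (p (x + t *\<^sub>R a) - t * p a)"
        by (simp only: sublinear_scaleR[OF p c]) (simp add: right_diff_distrib)
      finally show ?thesis using c False by (simp add: divide_le_eq mult.commute)
    qed
    then have "q (c *\<^sub>R x) / c \<le> q x" by (rule low)
    then show ?thesis using c False by (simp add: divide_le_eq mult.commute)
  qed
  ultimately show "sublinear q" unfolding sublinear_def by blast
qed

lemma sublinear_minorant:
  fixes q :: "'b::real_vector \<Rightarrow> real"
  assumes q: "sublinear q"
  shows "\<exists>f. linear f \<and> (\<forall>x. f x \<le> q x)"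
proof -
  define A where "A = {p. sublinear p \<and> p \<le> q}"
  define R where "R = (\<lambda>p p' :: 'b \<Rightarrow> real. p' \<le> p)"
  have "\<exists>m\<in>A. \<forall>a\<in>A. R m a \<longrightarrow> a = m"
  proof (rule predicate_Zorn)
    show "partial_order_on A (relation_of R A)"
      unfolding partial_order_on_def preorder_on_def refl_on_def trans_def antisym_def
        relation_of_def R_def by auto
    fix C assume C: "C \<in> Chains (relation_of R A)"
    show "\<exists>u\<in>A. \<forall>a\<in>C. R a u"
    proof (cases "C = {}")
      case True
      then show ?thesis using q by (auto simp: A_def)
    next
      case False
      have CA: "p \<in> A" if "p \<in> C" for p
        using C that unfolding Chains_def relation_of_def by auto
      have sub: "sublinear p" "p \<le> q" if "p \<in> C" for p
        using CA[OF that] by (auto simp: A_def)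
      have ch: "p \<le> p' \<or> p' \<le> p" if "p \<in> C" "p' \<in> C" for p p'
        using C that unfolding Chains_def relation_of_def R_def by auto
      define u where "u = (\<lambda>x. INF p\<in>C. p x)"
      have bdd: "bdd_below ((\<lambda>p. p x) ` C)" for x
      proof (rule bdd_belowI2[where m = "- q (- x)"])
        fix p assume "p \<in> C"
        then show "- q (- x) \<le> p x"
          using sublinear_neg[OF sub(1), of p x] le_funD[OF sub(2), of p "- x"] by simp
      qed
      have up: "u x \<le> p x" if "p \<in> C" for p x
        unfolding u_def by (rule cINF_lower[OF bdd that])
      have low: "z \<le> u x" if "\<And>p. p \<in> C \<Longrightarrow> z \<le> p x" for z x
        unfolding u_def by (rule cINF_greatest) (use False that in auto)
      have "u (x + y) \<le> u x + u y" for x y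
      proof -
        have "u (x + y) \<le> p x + p' y" if pp: "p \<in> C" "p' \<in> C" for p p'
        proof -
          obtain r where r: "r \<in> C" "r \<le> p" "r \<le> p'" using ch[OF pp] pp by blast
          have "u (x + y) \<le> r (x + y)" by (rule up[OF r(1)])
          also have "\<dots> \<le> r x + r y" using sub(1)[OF r(1)] unfolding sublinear_def by blast
          also have "\<dots> \<le> p x + p' y" using r by (intro add_mono) (auto simp: le_fun_def)
          finally show ?thesis .
        qed
        then have "u (x + y) - p x \<le> p' y" if "p \<in> C" "p' \<in> C" for p p'
          using that by fastforce
        then have "u (x + y) - p x \<le> u y" if "p \<in> C" for p
          using that by (intro low) blast
        then have "u (x + y) - u y \<le> p x" if "p \<in> C" for p
          using that by fastforce
        then have "u (x + y) - u y \<le> u x" by (intro low) blast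
        then show ?thesis by simp
      qed
      moreover have "u (c *\<^sub>R x) \<le> c * u x" if c: "0 \<le> c" for c x
      proof (cases "c = 0")
        case True
        obtain p where "p \<in> C" using False by blast
        then show ?thesis using up[of p 0] sublinear_zero[OF sub(1), of p] True by simp
      next
        case False
        have "u (c *\<^sub>R x) / c \<le> u x"
        proof (rule low)
          fix p assume "p \<in> C"
          then show "u (c *\<^sub>R x) / c \<le> p x"
            using up[of p "c *\<^sub>R x"] sublinear_scaleR[OF sub(1) c, of p x] c False
            by (simp add: divide_le_eq mult.commute)
        qed
        then show ?thesis using c False by (simp add: divide_le_eq mult.commute)
      qed
      moreover have "u \<le> q"
        using False up sub(2) by (metis ex_in_conv le_funI le_funD order_trans)
      ultimately have "u \<in> A" by (simp add: A_def sublinear_def)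
      then show ?thesis using up by (auto simp: R_def le_fun_def)
    qed
  qed
  then obtain f where f: "sublinear f" "f \<le> q" and min: "\<And>p. sublinear p \<Longrightarrow> p \<le> q \<Longrightarrow> p \<le> f \<Longrightarrow> p = f"
    by (auto simp: A_def R_def)
  have add: "f (x + a) = f x + f a" for x a
  proof -
    let ?q = "\<lambda>x. INF t\<in>{0::real..}. f (x + t *\<^sub>R a) - t * f a"
    have "?q \<le> f" using sublinear_shift(2)[OF f(1) refl] by (auto simp: le_fun_def)
    then have "?q = f" using f(2) by (intro min sublinear_shift(1)[OF f(1) refl]) auto
    then have "f x \<le> f (x + a) - f a" using sublinear_shift(3)[OF f(1) refl, of x a] by (metis (lifting))
    moreover have "f (x + a) \<le> f x + f a" using f(1) unfolding sublinear_def by blast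
    ultimately show ?thesis by simp
  qed
  have neg: "f (- x) = - f x" for x
    using add[of x "- x"] sublinear_zero[OF f(1)] by simp
  have "f (c *\<^sub>R x) = c * f x" for c x
  proof (cases "0 \<le> c")
    case True then show ?thesis by (rule sublinear_scaleR[OF f(1)])
  next
    case False
    then show ?thesis using sublinear_scaleR[OF f(1), of "- c" x] neg[of "c *\<^sub>R x"] by simp
  qed
  then have "linear f" by (intro linearI) (auto simp: add)
  then show ?thesis using f(2) by (auto simp: le_fun_def)
qed

text \<open>A consequence of the Hahn--Banach theorem.\<close>

lemma norming_functional:
  fixes y :: "'b::real_normed_vector"
  shows "\<exists>f :: 'b \<Rightarrow>\<^sub>L real. norm f \<le> 1 \<and> blinfun_apply f y = norm y"
proof -
  have sn: "sublinear (norm :: 'b \<Rightarrow> real)"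
    by (auto simp: sublinear_def norm_triangle_ineq)
  obtain f where f: "linear f"
    and le: "\<And>x. f x \<le> (INF t\<in>{0::real..}. norm (x + t *\<^sub>R y) - t * norm y)"
    using sublinear_minorant[OF sublinear_shift(1)[OF sn refl, of y]] by auto
  have le1: "f x \<le> norm x" for x
    using le[of x] sublinear_shift(2)[OF sn refl, of x y] by simp
  have "f (- y) \<le> norm (- y + y) - norm y"
    using le[of "- y"] sublinear_shift(3)[OF sn refl, of "- y" y] by linarith
  then have ge: "norm y \<le> f y" using linear_neg[OF f, of y] by simp
  have abs: "\<bar>f x\<bar> \<le> norm x" for x
    using le1[of x] le1[of "- x"] linear_neg[OF f, of x] by simp
  have bl: "bounded_linear f"
    using f abs by (auto simp: bounded_linear_def bounded_linear_axioms_def intro!: exI[of _ 1])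
  have "norm (Blinfun f) \<le> 1"
    by (rule norm_blinfun_bound) (use abs bl in \<open>auto simp: bounded_linear_Blinfun_apply\<close>)
  moreover have "blinfun_apply (Blinfun f) y = norm y"
    using ge le1[of y] bl by (simp add: bounded_linear_Blinfun_apply)
  ultimately show ?thesis by blast
qed

section \<open>Pointed complete metric spaces and spaces of Lipschitz maps\<close>

text \<open>The distinguished point is an arbitrary element of the space: the class imposes no axiom on it.\<close>

class pointed_complete_space = complete_space +
  fixes base_point :: 'a

definition lip_fun :: "('a::pointed_complete_space \<Rightarrow> 'b::real_normed_vector) \<Rightarrow> bool" where
  "lip_fun F \<longleftrightarrow> F base_point = 0 \<and> (\<exists>L. L-lipschitz_on UNIV F)"

text \<open>The pairs with \<open>p = q\<close> contribute the value \<open>0 / 0 = 0\<close>, so this is the usual supremum over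
  \<open>p \<noteq> q\<close>, and it is \<open>0\<close> on a one-point space.\<close>

definition lip_norm :: "('a::metric_space \<Rightarrow> 'b::real_normed_vector) \<Rightarrow> real" where
  "lip_norm F = (SUP (p, q). norm (F p - F q) / dist p q)"

lemma lip_norm_bdd:
  fixes F :: "'a::metric_space \<Rightarrow> 'b::real_normed_vector"
  assumes "L-lipschitz_on UNIV F"
  shows "norm (F p - F q) / dist p q \<le> L"
proof -
  have "norm (F p - F q) \<le> L * dist p q" "L \<ge> 0"
    using assms by (auto simp: lipschitz_on_def dist_norm)
  then show ?thesis by (cases "p = q") (auto simp: divide_le_eq)
qed

lemma lip_norm_le:
  fixes F :: "'a::metric_space \<Rightarrow> 'b::real_normed_vector"
  assumes "L-lipschitz_on UNIV F"
  shows "lip_norm F \<le> L"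
  unfolding lip_norm_def by (rule cSUP_least) (auto intro: lip_norm_bdd[OF assms])

lemma lip_norm_quotient:
  fixes F :: "'a::metric_space \<Rightarrow> 'b::real_normed_vector"
  assumes "L-lipschitz_on UNIV F"
  shows "norm (F p - F q) / dist p q \<le> lip_norm F"
proof -
  have "bdd_above (range (\<lambda>(p, q). norm (F p - F q) / dist p q))"
    by (rule bdd_aboveI[where M = L]) (auto intro: lip_norm_bdd[OF assms])
  from cSUP_upper[OF _ this, of "(p, q)"] show ?thesis
    unfolding lip_norm_def by simp
qed

lemma lip_norm_nonneg:
  fixes F :: "'a::metric_space \<Rightarrow> 'b::real_normed_vector"
  assumes "L-lipschitz_on UNIV F"
  shows "0 \<le> lip_norm F"
  using lip_norm_quotient[OF assms, of undefined undefined] by simp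

lemma lip_norm_lipschitz:
  fixes F :: "'a::metric_space \<Rightarrow> 'b::real_normed_vector"
  assumes "L-lipschitz_on UNIV F"
  shows "norm (F p - F q) \<le> lip_norm F * dist p q"
  using lip_norm_quotient[OF assms, of p q]
  by (cases "p = q") (auto simp: divide_le_eq)

lemma lipschitz_on_lip_norm:
  fixes F :: "'a::metric_space \<Rightarrow> 'b::real_normed_vector"
  assumes "L-lipschitz_on UNIV F"
  shows "(lip_norm F)-lipschitz_on UNIV F"
  using lip_norm_lipschitz[OF assms] lip_norm_nonneg[OF assms]
  by (auto simp: lipschitz_on_def dist_norm)

typedef (overloaded) ('a, 'b) lip0 =
  "{F :: 'a::pointed_complete_space \<Rightarrow> 'b::real_normed_vector. lip_fun F}"
  morphisms lip0_apply Lip0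
  by (rule exI[of _ "\<lambda>_. 0"]) (auto simp: lip_fun_def intro!: exI[of _ 0] lipschitz_on_constant)

setup_lifting type_definition_lip0

instantiation lip0 :: (pointed_complete_space, real_normed_vector) real_normed_vector
begin

lift_definition zero_lip0 :: "('a, 'b) lip0" is "\<lambda>_. 0"
  by (auto simp: lip_fun_def intro!: exI[of _ 0] lipschitz_on_constant)

lift_definition plus_lip0 :: "('a, 'b) lip0 \<Rightarrow> ('a, 'b) lip0 \<Rightarrow> ('a, 'b) lip0"
  is "\<lambda>F G p. F p + G p"
  by (auto simp: lip_fun_def intro: lipschitz_on_add)

lift_definition minus_lip0 :: "('a, 'b) lip0 \<Rightarrow> ('a, 'b) lip0 \<Rightarrow> ('a, 'b) lip0"
  is "\<lambda>F G p. F p - G p"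
  by (auto simp: lip_fun_def intro: lipschitz_on_diff)

lift_definition uminus_lip0 :: "('a, 'b) lip0 \<Rightarrow> ('a, 'b) lip0" is "\<lambda>F p. - F p"
  by (auto simp: lip_fun_def intro: lipschitz_on_minus)

lift_definition scaleR_lip0 :: "real \<Rightarrow> ('a, 'b) lip0 \<Rightarrow> ('a, 'b) lip0" is "\<lambda>c F p. c *\<^sub>R F p"
  by (auto simp: lip_fun_def intro: lipschitz_on_cmult)

lift_definition norm_lip0 :: "('a, 'b) lip0 \<Rightarrow> real" is lip_norm .

definition dist_lip0 :: "('a, 'b) lip0 \<Rightarrow> ('a, 'b) lip0 \<Rightarrow> real" where
  "dist_lip0 F G = norm (F - G)"

definition sgn_lip0 :: "('a, 'b) lip0 \<Rightarrow> ('a, 'b) lip0" where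
  "sgn_lip0 F = inverse (norm F) *\<^sub>R F"

definition uniformity_lip0 :: "(('a, 'b) lip0 \<times> ('a, 'b) lip0) filter" where
  "uniformity_lip0 = (INF e\<in>{0 <..}. principal {(F, G). dist F G < e})"

definition open_lip0 :: "('a, 'b) lip0 set \<Rightarrow> bool" where
  "open_lip0 S = (\<forall>F\<in>S. \<forall>\<^sub>F (F', G) in uniformity. F' = F \<longrightarrow> G \<in> S)"

instance
proof
  fix F G H :: "('a, 'b) lip0" and a b :: real
  show "F + G + H = F + (G + H)" "F + G = G + F" "0 + F = F" "- F + F = 0" "F - G = F + - G"
    "a *\<^sub>R (F + G) = a *\<^sub>R F + a *\<^sub>R G" "(a + b) *\<^sub>R F = a *\<^sub>R F + b *\<^sub>R F"
    "a *\<^sub>R b *\<^sub>R F = (a * b) *\<^sub>R F" "1 *\<^sub>R F = F"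
    by (transfer; auto simp: algebra_simps)+
  show "dist F G = norm (F - G)" by (rule dist_lip0_def)
  show "sgn F = inverse (norm F) *\<^sub>R F" by (rule sgn_lip0_def)
  show "(uniformity :: (('a, 'b) lip0 \<times> ('a, 'b) lip0) filter) =
      (INF e\<in>{0 <..}. principal {(F, G). dist F G < e})"
    by (rule uniformity_lip0_def)
  fix S :: "('a, 'b) lip0 set"
  show "open S = (\<forall>F\<in>S. \<forall>\<^sub>F (F', G) in uniformity. F' = F \<longrightarrow> G \<in> S)" by (rule open_lip0_def)
next
  fix F G :: "('a, 'b) lip0" and a :: real
  show "(norm F = 0) = (F = 0)"
  proof (transfer, safe)
    fix F :: "'a \<Rightarrow> 'b" assume F: "lip_fun F" and z: "lip_norm F = 0"
    then obtain L where L: "L-lipschitz_on UNIV F" by (auto simp: lip_fun_def)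
    have "F p = 0" for p
      using lip_norm_lipschitz[OF L, of p base_point] F z by (auto simp: lip_fun_def)
    then show "F = (\<lambda>_. 0)" by auto
  next
    show "lip_norm (\<lambda>_::'a. 0::'b) = 0" by (simp add: lip_norm_def case_prod_beta)
  qed
  show "norm (F + G) \<le> norm F + norm G"
    by transfer (auto simp: lip_fun_def intro!: lip_norm_le lipschitz_on_add lipschitz_on_lip_norm)
  have le: "norm (a *\<^sub>R F) \<le> \<bar>a\<bar> * norm F" for a and F :: "('a, 'b) lip0"
    by transfer (auto simp: lip_fun_def intro!: lip_norm_le lipschitz_on_cmult lipschitz_on_lip_norm)
  show "norm (a *\<^sub>R F) = \<bar>a\<bar> * norm F"
  proof (cases "a = 0")
    case True
    have "norm (0 :: ('a, 'b) lip0) = 0"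
      by transfer (simp add: lip_norm_def case_prod_beta)
    moreover have "a *\<^sub>R F = 0" using True by transfer auto
    ultimately show ?thesis using True by simp
  next
    case False
    have "F = inverse a *\<^sub>R (a *\<^sub>R F)" using False by transfer auto
    then have "norm F \<le> \<bar>inverse a\<bar> * norm (a *\<^sub>R F)" using le by metis
    then have "\<bar>a\<bar> * norm F \<le> norm (a *\<^sub>R F)" using False by (simp add: field_simps)
    with le show ?thesis by (simp add: antisym)
  qed
qed

end

lemma lip0_apply_base [simp]: "lip0_apply F base_point = 0"
  by transfer (simp add: lip_fun_def)

lemma norm_lip0_eq: "norm F = (SUP (p, q). norm (lip0_apply F p - lip0_apply F q) / dist p q)"
  by transfer (simp add: lip_norm_def)

lemma lip0_lipschitz: "norm (lip0_apply F p - lip0_apply F q) \<le> norm F * dist p q"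
  by transfer (auto simp: lip_fun_def intro: lip_norm_lipschitz)

lemma lip0_norm_le:
  assumes "0 \<le> L" "\<And>p q. norm (lip0_apply F p - lip0_apply F q) \<le> L * dist p q"
  shows "norm F \<le> L"
  using assms
  by transfer (auto simp: lip_fun_def lipschitz_on_def dist_norm intro!: lip_norm_le)

definition LipSNA :: "('a::pointed_complete_space, 'b::real_normed_vector) lip0 set" where
  "LipSNA = {F. \<exists>p q. p \<noteq> q \<and> norm (lip0_apply F p - lip0_apply F q) / dist p q = norm F}"

section \<open>The Lipschitz-free space\<close>

lift_definition eval_lip :: "'a::pointed_complete_space \<Rightarrow> ('a, real) lip0 \<Rightarrow>\<^sub>L real"
  is "\<lambda>p f. lip0_apply f p"
proof
  fix p :: 'a
  show "lip0_apply (f + g) p = lip0_apply f p + lip0_apply g p" for f g :: "('a, real) lip0"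
    by transfer simp
  show "lip0_apply (c *\<^sub>R f) p = c *\<^sub>R lip0_apply f p" for c and f :: "('a, real) lip0"
    by transfer simp
  show "\<exists>K. \<forall>f::('a, real) lip0. norm (lip0_apply f p) \<le> norm f * K"
  proof (intro exI allI)
    fix f :: "('a, real) lip0"
    show "norm (lip0_apply f p) \<le> norm f * dist p base_point"
      using lip0_lipschitz[of f p base_point] by simp
  qed
qed

typedef (overloaded) 'a lip_free =
  "closure (span (range (eval_lip :: 'a::pointed_complete_space \<Rightarrow> ('a, real) lip0 \<Rightarrow>\<^sub>L real)))"
  morphisms free_functional Lip_free
  using closure_subset span_zero by blast

setup_lifting type_definition_lip_free

lemma subspace_closure_span: "subspace (closure (span S))"
  for S :: "'b::real_normed_vector set"
proof (rule subspaceI)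
  show "0 \<in> closure (span S)" using closure_subset span_zero by blast
next
  fix x y assume "x \<in> closure (span S)" "y \<in> closure (span S)"
  then obtain f g where "\<And>n. f n \<in> span S" "f \<longlonglongrightarrow> x" "\<And>n. g n \<in> span S" "g \<longlonglongrightarrow> y"
    by (auto simp: closure_sequential)
  then show "x + y \<in> closure (span S)"
    unfolding closure_sequential
    by (intro exI[of _ "\<lambda>n. f n + g n"]) (auto intro: span_add tendsto_add)
next
  fix c :: real and x assume "x \<in> closure (span S)"
  then obtain f where "\<And>n. f n \<in> span S" "f \<longlonglongrightarrow> x"
    by (auto simp: closure_sequential)
  then show "c *\<^sub>R x \<in> closure (span S)"
    unfolding closure_sequential
    by (intro exI[of _ "\<lambda>n. c *\<^sub>R f n"]) (auto intro: span_scale tendsto_scaleR)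
qed

instantiation lip_free :: (pointed_complete_space) real_normed_vector
begin

lift_definition zero_lip_free :: "'a lip_free" is 0
  by (rule subspace_0[OF subspace_closure_span])

lift_definition plus_lip_free :: "'a lip_free \<Rightarrow> 'a lip_free \<Rightarrow> 'a lip_free" is "(+)"
  by (rule subspace_add[OF subspace_closure_span])

lift_definition minus_lip_free :: "'a lip_free \<Rightarrow> 'a lip_free \<Rightarrow> 'a lip_free" is "(-)"
  by (rule subspace_diff[OF subspace_closure_span])

lift_definition uminus_lip_free :: "'a lip_free \<Rightarrow> 'a lip_free" is uminus
  by (rule subspace_neg[OF subspace_closure_span])

lift_definition scaleR_lip_free :: "real \<Rightarrow> 'a lip_free \<Rightarrow> 'a lip_free" is "scaleR"
  by (rule subspace_scale[OF subspace_closure_span])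

lift_definition norm_lip_free :: "'a lip_free \<Rightarrow> real" is norm .

definition dist_lip_free :: "'a lip_free \<Rightarrow> 'a lip_free \<Rightarrow> real" where
  "dist_lip_free m n = norm (m - n)"

definition sgn_lip_free :: "'a lip_free \<Rightarrow> 'a lip_free" where
  "sgn_lip_free m = inverse (norm m) *\<^sub>R m"

definition uniformity_lip_free :: "('a lip_free \<times> 'a lip_free) filter" where
  "uniformity_lip_free = (INF e\<in>{0 <..}. principal {(m, n). dist m n < e})"

definition open_lip_free :: "'a lip_free set \<Rightarrow> bool" where
  "open_lip_free S = (\<forall>m\<in>S. \<forall>\<^sub>F (m', n) in uniformity. m' = m \<longrightarrow> n \<in> S)"

instance
proof
  fix m n k :: "'a lip_free" and a b :: real
  show "m + n + k = m + (n + k)" "m + n = n + m" "0 + m = m" "- m + m = 0" "m - n = m + - n"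
    "a *\<^sub>R (m + n) = a *\<^sub>R m + a *\<^sub>R n" "(a + b) *\<^sub>R m = a *\<^sub>R m + b *\<^sub>R m"
    "a *\<^sub>R b *\<^sub>R m = (a * b) *\<^sub>R m" "1 *\<^sub>R m = m"
    "(norm m = 0) = (m = 0)" "norm (m + n) \<le> norm m + norm n" "norm (a *\<^sub>R m) = \<bar>a\<bar> * norm m"
    by (transfer; simp add: scaleR_add_right scaleR_add_left norm_triangle_ineq)+
  show "dist m n = norm (m - n)" by (rule dist_lip_free_def)
  show "sgn m = inverse (norm m) *\<^sub>R m" by (rule sgn_lip_free_def)
  show "(uniformity :: ('a lip_free \<times> 'a lip_free) filter) =
      (INF e\<in>{0 <..}. principal {(m, n). dist m n < e})"
    by (rule uniformity_lip_free_def)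
  fix S :: "'a lip_free set"
  show "open S = (\<forall>m\<in>S. \<forall>\<^sub>F (m', n) in uniformity. m' = m \<longrightarrow> n \<in> S)" by (rule open_lip_free_def)
qed

end

lemma dist_free_functional: "dist (free_functional m) (free_functional n) = dist m n"
  unfolding dist_norm by transfer simp

instance lip_free :: (pointed_complete_space) banach
proof
  fix X :: "nat \<Rightarrow> 'a lip_free"
  assume "Cauchy X"
  then have "Cauchy (\<lambda>n. free_functional (X n))"
    by (simp add: Cauchy_def dist_free_functional)
  then obtain l where l: "(\<lambda>n. free_functional (X n)) \<longlonglongrightarrow> l"
    using Cauchy_convergent convergent_def by blast
  have "l \<in> closure (span (range eval_lip))"
    by (rule closed_sequentially[OF closed_closure _ l]) (rule free_functional)
  then have "l = free_functional (Lip_free l)" by (simp add: Lip_free_inverse)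
  with l have "X \<longlonglongrightarrow> Lip_free l"
    by (metis (no_types, lifting) LIMSEQ_iff_nz dist_free_functional metric_LIMSEQ_D metric_LIMSEQ_I)
  then show "convergent X" by (auto simp: convergent_def)
qed

lift_definition delta :: "'a::pointed_complete_space \<Rightarrow> 'a lip_free" is eval_lip
  by (meson closure_subset range_subsetD span_superset subset_trans subsetD rangeI)

lemma free_functional_delta [simp]: "free_functional (delta p) f = lip0_apply f p"
  by transfer (simp add: eval_lip.rep_eq)

lemma functional_separation:
  fixes v w :: "'b::real_normed_vector"
  assumes "\<And>y :: 'b \<Rightarrow>\<^sub>L real. blinfun_apply y v = blinfun_apply y w"
  shows "v = w"
proof -
  obtain y :: "'b \<Rightarrow>\<^sub>L real" where "blinfun_apply y (v - w) = norm (v - w)"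
    using norming_functional by blast
  then show ?thesis using assms[of y] by (simp add: blinfun.diff_right)
qed

lemma norm_le_by_functionals:
  fixes v :: "'b::real_normed_vector"
  assumes "\<And>y :: 'b \<Rightarrow>\<^sub>L real. norm y \<le> 1 \<Longrightarrow> blinfun_apply y v \<le> K"
  shows "norm v \<le> K"
  using norming_functional[of v] assms by metis

lift_definition lip0_compose ::
  "('b::real_normed_vector \<Rightarrow>\<^sub>L real) \<Rightarrow> ('a::pointed_complete_space, 'b) lip0 \<Rightarrow> ('a, real) lip0"
  is "\<lambda>y F p. blinfun_apply y (F p)"
proof -
  fix y :: "'b \<Rightarrow>\<^sub>L real" and F :: "'a \<Rightarrow> 'b"
  assume F: "lip_fun F"
  then obtain L where L: "L-lipschitz_on UNIV F" by (auto simp: lip_fun_def)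
  have "norm (blinfun_apply y (F p) - blinfun_apply y (F q)) \<le> (norm y * L) * dist p q" for p q
  proof -
    have "norm (blinfun_apply y (F p - F q)) \<le> norm y * norm (F p - F q)"
      by (rule norm_blinfun)
    also have "\<dots> \<le> norm y * (L * dist p q)"
      using L by (intro mult_left_mono) (auto simp: lipschitz_on_def dist_norm)
    finally show ?thesis by (simp add: blinfun.diff_right mult.assoc)
  qed
  then have "(norm y * L)-lipschitz_on UNIV (\<lambda>p. blinfun_apply y (F p))"
    using L by (auto simp: lipschitz_on_def dist_norm)
  then show "lip_fun (\<lambda>p. blinfun_apply y (F p))"
    using F by (auto simp: lip_fun_def)
qed

lemma norm_lip0_compose: "norm (lip0_compose y F) \<le> norm y * norm F"
proof (rule lip0_norm_le)
  fix p q
  have "norm (lip0_apply (lip0_compose y F) p - lip0_apply (lip0_compose y F) q)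
      = norm (blinfun_apply y (lip0_apply F p - lip0_apply F q))"
    by (simp add: lip0_compose.rep_eq blinfun.diff_right)
  also have "\<dots> \<le> norm y * norm (lip0_apply F p - lip0_apply F q)"
    by (rule norm_blinfun)
  also have "\<dots> \<le> norm y * (norm F * dist p q)"
    by (intro mult_left_mono lip0_lipschitz) auto
  finally show "norm (lip0_apply (lip0_compose y F) p - lip0_apply (lip0_compose y F) q)
      \<le> norm y * norm F * dist p q" by (simp add: mult.assoc)
qed simp

lemma linear_free_functional: "linear free_functional"
  by (rule linearI) (transfer; simp)+

lemma closure_span_delta: "closure (span (range delta)) = (UNIV :: 'a::pointed_complete_space lip_free set)"
proof -
  have eq: "span (range eval_lip) = free_functional ` span (range (delta :: 'a \<Rightarrow> _))"
  proof -
    have "range eval_lip = free_functional ` range (delta :: 'a \<Rightarrow> _)"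
      by (simp add: image_image delta.rep_eq)
    then show ?thesis by (simp add: linear_span_image[OF linear_free_functional])
  qed
  have "m \<in> closure (span (range delta))" for m :: "'a lip_free"
  proof -
    have "\<exists>x\<in>span (range delta). dist x m < e" if "e > 0" for e
      using free_functional[of m] that unfolding closure_approachable eq
      by (auto simp: dist_free_functional)
    then show ?thesis by (simp add: closure_approachable)
  qed
  then show ?thesis by auto
qed

lemma lip_free_operator_eqI:
  fixes S T :: "'a::pointed_complete_space lip_free \<Rightarrow>\<^sub>L 'b::real_normed_vector"
  assumes "\<And>p. blinfun_apply S (delta p) = blinfun_apply T (delta p)"
  shows "S = T"
proof (rule blinfun_eqI)
  fix m :: "'a lip_free"
  let ?K = "{m. blinfun_apply S m = blinfun_apply T m}"
  have "subspace ?K" by (rule subspaceI) (auto simp: blinfun.add_right blinfun.scaleR_right)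
  then have "span (range delta) \<subseteq> ?K" using assms by (intro span_minimal) auto
  moreover have "closed ?K" by (intro closed_Collect_eq continuous_intros)
  ultimately have "closure (span (range delta)) \<subseteq> ?K" by (rule closure_minimal)
  then show "blinfun_apply S m = blinfun_apply T m" by (auto simp: closure_span_delta)
qed

text \<open>The unique operator on the free space that maps \<open>delta p\<close> to \<open>F p\<close>. It exists, and the
  assignment is an isometric isomorphism, by \<open>linearization_delta\<close>, \<open>norm_linearization\<close>,
  \<open>linear_linearization\<close> and \<open>bij_linearization\<close> below.\<close>

definition linearization ::
  "('a::pointed_complete_space, 'b::banach) lip0 \<Rightarrow> 'a lip_free \<Rightarrow>\<^sub>L 'b" where
  "linearization F = (THE T. \<forall>p. blinfun_apply T (delta p) = lip0_apply F p)"

lemma linearization_eqI: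
  assumes "\<And>p. blinfun_apply T (delta p) = lip0_apply F p"
  shows "linearization F = T"
  unfolding linearization_def
  by (rule the_equality) (use assms in \<open>auto intro: lip_free_operator_eqI\<close>)

lemma linearization_witness:
  fixes F :: "('a::pointed_complete_space, 'b::banach) lip0"
  shows "\<exists>v. \<forall>y. blinfun_apply y v = blinfun_apply (free_functional m) (lip0_compose y F)"
proof -
  define A where "A = {\<mu>. \<exists>v. \<forall>y. blinfun_apply y v = blinfun_apply \<mu> (lip0_compose y F)}"
  have "eval_lip p \<in> A" for p
    by (auto simp: A_def eval_lip.rep_eq lip0_compose.rep_eq)
  moreover have "subspace A"
  proof (rule subspaceI)
    show "0 \<in> A" by (auto simp: A_def intro!: exI[of _ 0] blinfun.zero_right)
    fix \<mu> \<nu> assume "\<mu> \<in> A" "\<nu> \<in> A"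
    then obtain v w where "\<And>y. blinfun_apply y v = blinfun_apply \<mu> (lip0_compose y F)"
      "\<And>y. blinfun_apply y w = blinfun_apply \<nu> (lip0_compose y F)" by (auto simp: A_def)
    then show "\<mu> + \<nu> \<in> A"
      by (auto simp: A_def blinfun.add_left blinfun.add_right intro!: exI[of _ "v + w"])
  next
    fix c :: real and \<mu> assume "\<mu> \<in> A"
    then obtain v where "\<And>y. blinfun_apply y v = blinfun_apply \<mu> (lip0_compose y F)"
      by (auto simp: A_def)
    then show "c *\<^sub>R \<mu> \<in> A"
      by (auto simp: A_def blinfun.scaleR_left blinfun.scaleR_right intro!: exI[of _ "c *\<^sub>R v"])
  qed
  ultimately have "span (range eval_lip) \<subseteq> A" by (intro span_minimal) auto
  moreover have "closed A"
    unfolding closed_sequential_limits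
  proof (intro allI impI, elim conjE)
    fix \<mu> l assume \<mu>: "\<forall>n. \<mu> n \<in> A" "\<mu> \<longlonglongrightarrow> l"
    then obtain v where v: "\<And>n y. blinfun_apply y (v n) = blinfun_apply (\<mu> n) (lip0_compose y F)"
      unfolding A_def mem_Collect_eq by metis
    have dv: "dist (v i) (v j) \<le> dist (\<mu> i) (\<mu> j) * norm F" for i j
      unfolding dist_norm[of "v i"]
    proof (rule norm_le_by_functionals)
      fix y :: "'b \<Rightarrow>\<^sub>L real" assume y: "norm y \<le> 1"
      have "blinfun_apply y (v i - v j) = blinfun_apply (\<mu> i - \<mu> j) (lip0_compose y F)"
        by (simp add: v blinfun.diff_left blinfun.diff_right)
      also have "\<dots> \<le> norm (\<mu> i - \<mu> j) * norm (lip0_compose y F)"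
        using norm_blinfun[of "\<mu> i - \<mu> j" "lip0_compose y F"] by simp
      also have "\<dots> \<le> norm (\<mu> i - \<mu> j) * norm F"
        using norm_lip0_compose[of y F] y mult_right_mono[OF y norm_ge_zero[of F]]
        by (intro mult_left_mono) auto
      finally show "blinfun_apply y (v i - v j) \<le> dist (\<mu> i) (\<mu> j) * norm F"
        by (simp add: dist_norm)
    qed
    have "Cauchy v"
    proof (rule metric_CauchyI)
      fix e :: real assume e: "e > 0"
      have "Cauchy \<mu>" using \<mu>(2) LIMSEQ_imp_Cauchy by blast
      moreover have "e / (norm F + 1) > 0" using e norm_ge_zero[of F] by (simp add: add_nonneg_pos)
      ultimately obtain N where N: "\<And>i j. i \<ge> N \<Longrightarrow> j \<ge> N \<Longrightarrow> dist (\<mu> i) (\<mu> j) < e / (norm F + 1)"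
        unfolding Cauchy_def by meson
      have "dist (v i) (v j) < e" if "i \<ge> N" "j \<ge> N" for i j
      proof -
        have "dist (v i) (v j) \<le> dist (\<mu> i) (\<mu> j) * norm F" by (rule dv)
        also have "\<dots> \<le> dist (\<mu> i) (\<mu> j) * (norm F + 1)" by (intro mult_left_mono) auto
        also have "\<dots> < e"
          using N[OF that] norm_ge_zero[of F] by (simp add: pos_less_divide_eq add_nonneg_pos)
        finally show ?thesis .
      qed
      then show "\<exists>M. \<forall>m\<ge>M. \<forall>n\<ge>M. dist (v m) (v n) < e" by blast
    qed
    then obtain w where w: "v \<longlonglongrightarrow> w" using Cauchy_convergent convergent_def by blast
    have "blinfun_apply y w = blinfun_apply l (lip0_compose y F)" for y
    proof (rule LIMSEQ_unique)
      show "(\<lambda>n. blinfun_apply y (v n)) \<longlonglongrightarrow> blinfun_apply y w"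
        by (intro tendsto_intros w)
      show "(\<lambda>n. blinfun_apply y (v n)) \<longlonglongrightarrow> blinfun_apply l (lip0_compose y F)"
        unfolding v by (intro tendsto_intros \<mu>(2))
    qed
    then show "l \<in> A" by (auto simp: A_def)
  qed
  ultimately have "closure (span (range eval_lip)) \<subseteq> A" by (rule closure_minimal)
  then show ?thesis using free_functional[of m] by (auto simp: A_def)
qed

lemma linearization_exists:
  fixes F :: "('a::pointed_complete_space, 'b::banach) lip0"
  shows "\<exists>T. norm T \<le> norm F \<and> (\<forall>p. blinfun_apply T (delta p) = lip0_apply F p)"
proof -
  obtain h where h: "\<And>m y. blinfun_apply y (h m :: 'b)
      = blinfun_apply (free_functional m) (lip0_compose y F)"
    using linearization_witness[of _ F] by metis
  have add: "h (m + n) = h m + h n" for m n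
    by (rule functional_separation)
      (simp add: h blinfun.add_right plus_lip_free.rep_eq blinfun.add_left)
  have scale: "h (c *\<^sub>R m) = c *\<^sub>R h m" for c m
    by (rule functional_separation)
      (simp add: h blinfun.scaleR_right scaleR_lip_free.rep_eq blinfun.scaleR_left)
  have bound: "norm (h m) \<le> norm F * norm m" for m
  proof (rule norm_le_by_functionals)
    fix y :: "'b \<Rightarrow>\<^sub>L real" assume y: "norm y \<le> 1"
    have "blinfun_apply y (h m) \<le> norm (free_functional m) * norm (lip0_compose y F)"
      using norm_blinfun[of "free_functional m" "lip0_compose y F"] by (simp add: h)
    also have "\<dots> \<le> norm (free_functional m) * norm F"
      using norm_lip0_compose[of y F] mult_right_mono[OF y norm_ge_zero[of F]]
      by (intro mult_left_mono) auto
    finally show "blinfun_apply y (h m) \<le> norm F * norm m"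
      by (simp add: norm_lip_free.rep_eq mult.commute)
  qed
  have bl: "bounded_linear h"
    by (rule bounded_linear_intro[where K = "norm F"])
      (use add scale bound in \<open>auto simp: mult.commute\<close>)
  have "h (delta p) = lip0_apply F p" for p
    by (rule functional_separation) (simp add: h lip0_compose.rep_eq)
  moreover have "norm (Blinfun h) \<le> norm F"
    by (rule norm_blinfun_bound) (use bl bound in \<open>auto simp: bounded_linear_Blinfun_apply\<close>)
  ultimately show ?thesis
    using bl by (intro exI[of _ "Blinfun h"]) (auto simp: bounded_linear_Blinfun_apply)
qed

lemma linearization_delta [simp]: "blinfun_apply (linearization F) (delta p) = lip0_apply F p"
  using linearization_exists[of F] linearization_eqI by metis

lemma norm_delta_diff: "norm (delta p - delta q) \<le> dist p q"
  unfolding norm_lip_free.rep_eq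
proof (rule norm_blinfun_bound)
  fix f :: "('a, real) lip0"
  show "norm (blinfun_apply (free_functional (delta p - delta q)) f) \<le> dist p q * norm f"
    using lip0_lipschitz[of f p q]
    by (simp add: minus_lip_free.rep_eq blinfun.diff_left mult.commute)
qed simp

lemma norm_linearization: "norm (linearization F) = norm F"
proof (rule antisym)
  show "norm (linearization F) \<le> norm F"
    using linearization_exists[of F] linearization_eqI by metis
  show "norm F \<le> norm (linearization F)"
  proof (rule lip0_norm_le)
    fix p q
    have "norm (lip0_apply F p - lip0_apply F q) = norm (blinfun_apply (linearization F) (delta p - delta q))"
      by (simp add: blinfun.diff_right)
    also have "\<dots> \<le> norm (linearization F) * norm (delta p - delta q)" by (rule norm_blinfun)
    also have "\<dots> \<le> norm (linearization F) * dist p q"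
      by (intro mult_left_mono norm_delta_diff) auto
    finally show "norm (lip0_apply F p - lip0_apply F q) \<le> norm (linearization F) * dist p q" .
  qed simp
qed

lemma linear_linearization: "linear linearization"
proof (rule linearI)
  show "linearization (F + G) = linearization F + linearization G" for F G :: "('a, 'b) lip0"
    by (rule linearization_eqI) (simp add: blinfun.add_left plus_lip0.rep_eq)
  show "linearization (c *\<^sub>R F) = c *\<^sub>R linearization F" for c and F :: "('a, 'b) lip0"
    by (rule linearization_eqI) (simp add: blinfun.scaleR_left scaleR_lip0.rep_eq)
qed

lemma bij_linearization:
  "bij (linearization :: ('a::pointed_complete_space, 'b::banach) lip0 \<Rightarrow> _)"
proof (rule bijI)
  show "inj (linearization :: ('a, 'b) lip0 \<Rightarrow> _)"
    by (metis injI linearization_delta lip0_apply_inject ext)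
  show "surj (linearization :: ('a, 'b) lip0 \<Rightarrow> _)"
    unfolding surj_def
  proof
    fix T :: "'a lip_free \<Rightarrow>\<^sub>L 'b"
    have "free_functional (delta base_point) = free_functional (0 :: 'a lip_free)"
      by (rule blinfun_eqI) (simp add: zero_lip_free.rep_eq)
    then have d0: "delta base_point = (0 :: 'a lip_free)" by (simp add: free_functional_inject)
    have "norm (blinfun_apply T (delta p) - blinfun_apply T (delta q)) \<le> norm T * dist p q" for p q
    proof -
      have "norm (blinfun_apply T (delta p - delta q)) \<le> norm T * norm (delta p - delta q)"
        by (rule norm_blinfun)
      also have "\<dots> \<le> norm T * dist p q" by (intro mult_left_mono norm_delta_diff) auto
      finally show ?thesis by (simp add: blinfun.diff_right)
    qed
    then have "(norm T)-lipschitz_on UNIV (\<lambda>p. blinfun_apply T (delta p))"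
      by (auto simp: lipschitz_on_def dist_norm)
    then have "lip_fun (\<lambda>p. blinfun_apply T (delta p))"
      by (auto simp: lip_fun_def d0 blinfun.zero_right)
    then have "linearization (Lip0 (\<lambda>p. blinfun_apply T (delta p))) = T"
      by (intro linearization_eqI) (simp add: Lip0_inverse)
    then show "\<exists>F. T = linearization F" by metis
  qed
qed

section \<open>Flat operators and ACK structure\<close>

text \<open>For functionals, pointwise convergence on the predual is weak-star convergence, so the
  library's strong operator topology on \<open>'b \<Rightarrow>\<^sub>L real\<close> is the weak-star topology of the dual.\<close>

abbreviation weak_star :: "('b::real_normed_vector \<Rightarrow>\<^sub>L real) topology" where
  "weak_star \<equiv> strong_operator_topology"

definition adjoint_op ::
  "('a::real_normed_vector \<Rightarrow>\<^sub>L 'b::real_normed_vector) \<Rightarrow> ('b \<Rightarrow>\<^sub>L real) \<Rightarrow> ('a \<Rightarrow>\<^sub>L real)" where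
  "adjoint_op T y = y o\<^sub>L T"

text \<open>Boundedness is required explicitly because \<open>diameter\<close> is a junk value on unbounded sets.\<close>

definition flat_operators ::
  "('b::banach \<Rightarrow>\<^sub>L real) set \<Rightarrow> ('a::real_normed_vector \<Rightarrow>\<^sub>L 'b) set" where
  "flat_operators \<Gamma> = {T. \<forall>U. openin weak_star U \<and> U \<inter> \<Gamma> \<noteq> {} \<longrightarrow>
     (\<forall>\<epsilon>>0. \<exists>V. openin weak_star V \<and> V \<subseteq> U \<and> V \<inter> \<Gamma> \<noteq> {} \<and>
        bounded (adjoint_op T ` (V \<inter> \<Gamma>)) \<and> diameter (adjoint_op T ` (V \<inter> \<Gamma>)) < \<epsilon>)}"

definition one_norming :: "('b::real_normed_vector \<Rightarrow>\<^sub>L real) set \<Rightarrow> bool" where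
  "one_norming \<Gamma> \<longleftrightarrow> \<Gamma> \<subseteq> cball 0 1 \<and> (\<forall>y. norm y = (SUP f\<in>\<Gamma>. \<bar>blinfun_apply f y\<bar>))"

definition absolutely_convex :: "'b::real_vector set \<Rightarrow> bool" where
  "absolutely_convex C \<longleftrightarrow>
     (\<forall>x\<in>C. \<forall>y\<in>C. \<forall>a b. \<bar>a\<bar> + \<bar>b\<bar> \<le> 1 \<longrightarrow> a *\<^sub>R x + b *\<^sub>R y \<in> C)"

text \<open>The predicate says that \<open>\<Gamma>\<close> is a 1-norming set witnessing that the space has ACK structure
  with parameter \<open>\<rho>\<close>. Here \<open>adjoint_op F\<close> is \<open>F\<^sup>*\<close>, and \<open>absolutely_convex hull\<close> is the (not
  closed) absolutely convex hull.\<close>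

definition ACK_structure :: "real \<Rightarrow> ('b::banach \<Rightarrow>\<^sub>L real) set \<Rightarrow> bool" where
  "ACK_structure \<rho> \<Gamma> \<longleftrightarrow> one_norming \<Gamma> \<and>
     (\<forall>\<epsilon>>0. \<forall>U. openin (subtopology weak_star \<Gamma>) U \<and> U \<noteq> {} \<longrightarrow>
       (\<exists>V y1 e. \<exists>F :: 'b \<Rightarrow>\<^sub>L 'b. V \<noteq> {} \<and> V \<subseteq> U \<and> y1 \<in> V \<and> e \<in> sphere 0 1 \<and>
          norm (blinfun_apply F e) = 1 \<and> norm F = 1 \<and>
          blinfun_apply y1 (blinfun_apply F e) = 1 \<and>
          adjoint_op F y1 = y1 \<and>
          (let V1 = {y\<in>\<Gamma>. norm (adjoint_op F y) + (1 - \<epsilon>) * norm (y - adjoint_op F y) \<le> 1}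
           in \<forall>v\<in>\<Gamma> - V1. \<bar>blinfun_apply v (blinfun_apply F e)\<bar> \<le> \<rho>) \<and>
          (\<forall>y\<in>\<Gamma>. infdist (adjoint_op F y) (absolutely_convex hull ({0} \<union> V)) < \<epsilon>) \<and>
          (\<forall>v\<in>V. \<bar>blinfun_apply v e - 1\<bar> \<le> \<epsilon>)))"

end

theory Submission
  imports Defs
begin

text \<open>Flatness gives a weak-star open set on which \<open>T\<^sup>*\<close> is nearly constant on \<open>\<Gamma>\<close> and where
  \<open>\<parallel>T\<^sup>* y\<parallel>\<close> is nearly \<open>\<parallel>T\<parallel>\<close>. Apply the ACK structure inside it to get \<open>V\<close>, \<open>y\<^sub>1\<close>, \<open>e\<close>, \<open>F\<close>, and choose a
  strongly norm-attaining real function \<open>g\<close> near \<open>T\<^sup>* y\<^sub>1\<close>. The operator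
  \<open>S x = g(x) F e + (1 - \<epsilon>) (T x - F T x)\<close> then satisfies \<open>S\<^sup>* y\<^sub>1 = g\<close>, and it has norm at most \<open>\<parallel>g\<parallel>\<close>,
  so it attains its norm at the same pair of points as \<open>g\<close>. It is close to \<open>T\<close> because \<open>F\<^sup>* y\<close> lies
  near the absolutely convex hull of \<open>V\<close>, where \<open>T\<^sup>* b\<close> is close to \<open>b(e) g\<close>.\<close>

section \<open>Norm estimates through one-norming sets and adjoints\<close>

lemma one_norming_le:
  assumes "one_norming \<Gamma>" and "0 \<le> c" and "\<And>f. f \<in> \<Gamma> \<Longrightarrow> \<bar>blinfun_apply f y\<bar> \<le> c"
  shows "norm y \<le> c"
proof -
  have eq: "norm z = (SUP f\<in>\<Gamma>. \<bar>blinfun_apply f z\<bar>)" for z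
    using assms(1) by (simp add: one_norming_def)
  show ?thesis
  proof (cases "\<Gamma> = {}")
    \<comment> \<open>Over an empty \<open>\<Gamma>\<close> the supremum is one default value for
      all vectors, so every norm equals \<open>norm 0\<close>.\<close>
    case True
    then have "norm y = norm (0 :: 'a)" using eq[of y] eq[of 0] by simp
    then show ?thesis using assms(2) by simp
  next
    case False
    then show ?thesis unfolding eq[of y] by (rule cSUP_least) (rule assms(3))
  qed
qed

text \<open>Reduces the bounds on \<open>S\<close> and \<open>S - T\<close> to adjoints on
  \<open>\<Gamma>\<close>, where the ACK conditions give control.\<close>

lemma norm_blinfun_le_one_norming:
  fixes R :: "'a::real_normed_vector \<Rightarrow>\<^sub>L 'b::real_normed_vector"
  assumes \<Gamma>: "one_norming \<Gamma>" and c: "0 \<le> c"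
    and le: "\<And>f. f \<in> \<Gamma> \<Longrightarrow> norm (adjoint_op R f) \<le> c"
  shows "norm R \<le> c"
proof (rule norm_blinfun_bound[OF c])
  fix x
  show "norm (blinfun_apply R x) \<le> c * norm x"
  proof (rule one_norming_le[OF \<Gamma>])
    fix f assume "f \<in> \<Gamma>"
    have "\<bar>blinfun_apply f (blinfun_apply R x)\<bar> \<le> norm (adjoint_op R f) * norm x"
      using norm_blinfun[of "adjoint_op R f" x] by (simp add: adjoint_op_def)
    also have "\<dots> \<le> c * norm x" using le[OF \<open>f \<in> \<Gamma>\<close>] by (simp add: mult_right_mono)
    finally show "\<bar>blinfun_apply f (blinfun_apply R x)\<bar> \<le> c * norm x" .
  qed (use c in simp)
qed

lemma adjoint_op_diff: "adjoint_op T (f - g) = adjoint_op T f - adjoint_op T g"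
  by (rule blinfun_eqI) (simp add: adjoint_op_def blinfun.diff_left)

lemma norm_adjoint_op_le: "norm (adjoint_op T f) \<le> norm f * norm T"
  unfolding adjoint_op_def by (rule norm_blinfun_compose)

lemma openin_weak_star_abs_gt: "openin weak_star {f. c < \<bar>blinfun_apply f v\<bar>}"
proof -
  have "open {t :: real. c < \<bar>t\<bar>}" by (intro open_Collect_less continuous_intros)
  then have "openin weak_star {f \<in> topspace weak_star. blinfun_apply f v \<in> {t :: real. c < \<bar>t\<bar>}}"
    using openin_continuous_map_preimage[OF strong_operator_topology_continuous_evaluation]
    by (metis open_openin)
  then show ?thesis by (simp add: strong_operator_topology_topspace)
qed

text \<open>By minimality of the hull, a bound on \<open>V\<close> thus extends to
  \<open>absolutely_convex hull ({0} \<union> V)\<close>.\<close>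

lemma absolutely_convex_norm_le:
  assumes "linear L"
  shows "absolutely_convex {a. norm (L a) \<le> c}"
  unfolding absolutely_convex_def
proof (intro ballI allI impI)
  fix x y and a b :: real
  assume xy: "x \<in> {a. norm (L a) \<le> c}" "y \<in> {a. norm (L a) \<le> c}" and ab: "\<bar>a\<bar> + \<bar>b\<bar> \<le> 1"
  have c: "0 \<le> c" using xy(1) norm_ge_zero order_trans by blast
  have "norm (L (a *\<^sub>R x + b *\<^sub>R y)) \<le> \<bar>a\<bar> * norm (L x) + \<bar>b\<bar> * norm (L y)"
    using norm_triangle_ineq[of "a *\<^sub>R L x" "b *\<^sub>R L y"]
    by (simp add: linear_add[OF assms] linear_scale[OF assms])
  also have "\<dots> \<le> \<bar>a\<bar> * c + \<bar>b\<bar> * c" using xy by (intro add_mono mult_left_mono) auto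
  also have "\<dots> \<le> 1 * c"
    unfolding distrib_right[symmetric] by (rule mult_right_mono[OF ab c])
  finally show "a *\<^sub>R x + b *\<^sub>R y \<in> {a. norm (L a) \<le> c}" by simp
qed

section \<open>Approximation of a flat operator\<close>

text \<open>\<open>D\<close> stands for the strongly norm-attaining real functions. As
  \<open>norm y \<le> 1\<close>, the last inequality is an equality, which lets norm attainment pass
  from \<open>adjoint_op S y\<close> to \<open>S\<close>.\<close>

lemma flat_operator_approximation:
  fixes T :: "'a::real_normed_vector \<Rightarrow>\<^sub>L 'b::banach"
  assumes ack: "ACK_structure \<rho> \<Gamma>" and \<rho>: "0 \<le> \<rho>" "\<rho> < 1"
    and flat: "T \<in> flat_operators \<Gamma>" and T0: "T \<noteq> 0"
    and dense: "closure D = (UNIV :: ('a \<Rightarrow>\<^sub>L real) set)" and \<epsilon>: "0 < \<epsilon>" "\<epsilon> \<le> 1"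
  shows "\<exists>S y. norm (S - T) \<le> 3 * norm T * \<epsilon> \<and> norm y \<le> 1 \<and> adjoint_op S y \<in> D
    \<and> norm S \<le> norm (adjoint_op S y)"
proof -
  define K where "K = norm T"
  have K: "K > 0" using T0 by (simp add: K_def)
  \<comment> \<open>The common tolerance for flatness, ACK and density. Here
    \<open>3 * K + 6\<close> is the coefficient \<open>3 * K + 4\<close> of \<open>\<eta>\<close>
    plus 2 for the loss in \<open>K - 2 * d \<le> norm g\<close>; together they use up the slack
    \<open>K * \<epsilon> * (1 - \<rho>)\<close>.\<close>
  define d where "d = K * \<epsilon> * (1 - \<rho>) / (3 * K + 6)"
  have d: "d > 0" using K \<epsilon> \<rho> by (simp add: d_def)
  have dK: "d * (3 * K + 6) = K * \<epsilon> * (1 - \<rho>)" using K by (simp add: d_def)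
  have Ke: "K * \<epsilon> * (1 - \<rho>) \<le> K * \<epsilon>" "K * \<epsilon> \<le> K"
    using K \<epsilon> \<rho> by (auto simp: mult_le_cancel_left1)
  have dexp: "3 * (d * K) + 6 * d \<le> K * \<epsilon>" using dK Ke by (simp add: algebra_simps)
  have dpos: "0 < d * K" using d K by simp
  have dltK: "d < K" using dexp Ke dpos d by linarith
  have d1: "d < 1"
  proof -
    have "d * (3 * K + 6) < 1 * (3 * K + 6)"
      unfolding dK by (rule le_less_trans[OF order_trans[OF Ke]]) (use K in simp)
    then show ?thesis using K by (simp only: mult_less_cancel_right)
  qed
  have \<Gamma>: "one_norming \<Gamma>" using ack by (simp add: ACK_structure_def)
  have \<Gamma>1: "norm f \<le> 1" if "f \<in> \<Gamma>" for f
    using \<Gamma> that by (auto simp: one_norming_def)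
  obtain x where x: "(K - d) * norm x < norm (blinfun_apply T x)"
    using norm_blinfun_bound[of "K - d" T] dltK d K_def by (auto simp: not_le[symmetric])
  \<comment> \<open>Every \<open>f\<close> in \<open>U\<close> satisfies
    \<open>norm (adjoint_op T f) > K - d\<close>; keeping the factor \<open>norm x\<close> avoids
    normalizing \<open>x\<close>.\<close>
  define U where "U = {f. (K - d) * norm x < \<bar>blinfun_apply f (blinfun_apply T x)\<bar>}"
  have "U \<inter> \<Gamma> \<noteq> {}"
  proof
    assume "U \<inter> \<Gamma> = {}"
    then have "norm (blinfun_apply T x) \<le> (K - d) * norm x"
      using dltK by (intro one_norming_le[OF \<Gamma>]) (auto simp: U_def disjoint_iff not_less)
    then show False using x by simp
  qed
  moreover have "openin weak_star U" unfolding U_def by (rule openin_weak_star_abs_gt)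
  ultimately obtain W where W: "openin weak_star W" "W \<subseteq> U" "W \<inter> \<Gamma> \<noteq> {}"
    and bdd: "bounded (adjoint_op T ` (W \<inter> \<Gamma>))" and diam: "diameter (adjoint_op T ` (W \<inter> \<Gamma>)) < d"
    using flat d unfolding flat_operators_def by blast
  \<comment> \<open>Choosing \<open>V\<close> inside \<open>W \<inter> \<Gamma>\<close> gives it
    both the lower bound from \<open>U\<close> and the small diameter of the adjoint image.\<close>
  have "openin (subtopology weak_star \<Gamma>) (W \<inter> \<Gamma>)"
    using W(1) by (auto simp: openin_subtopology)
  then obtain V y1 e F where V: "V \<subseteq> W \<inter> \<Gamma>" and y1: "y1 \<in> V"
    and e: "norm e = 1" and F: "norm F = 1"
    and y1F: "blinfun_apply y1 (blinfun_apply F e) = 1" "adjoint_op F y1 = y1"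
    and V1: "\<forall>v\<in>\<Gamma> - {y\<in>\<Gamma>. norm (adjoint_op F y) + (1 - d) * norm (y - adjoint_op F y) \<le> 1}.
        \<bar>blinfun_apply v (blinfun_apply F e)\<bar> \<le> \<rho>"
    and aco: "\<forall>y\<in>\<Gamma>. infdist (adjoint_op F y) (absolutely_convex hull ({0} \<union> V)) < d"
    and Ve: "\<forall>v\<in>V. \<bar>blinfun_apply v e - 1\<bar> \<le> d"
    using ack[unfolded ACK_structure_def Let_def, THEN conjunct2, rule_format, OF d, of "W \<inter> \<Gamma>"] W(3)
    by (elim meta_impE exE conjE) (auto simp only: sphere_def dist_0_norm mem_Collect_eq)
  define f1 where "f1 = adjoint_op T y1"
  have f1: "K - d \<le> norm f1"
  proof -
    have "y1 \<in> U" using y1 V W by auto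
    then have "(K - d) * norm x < norm f1 * norm x"
      using norm_blinfun[of f1 x] by (simp add: U_def f1_def adjoint_op_def)
    then show ?thesis by (simp add: mult_less_cancel_right)
  qed
  obtain g where g: "g \<in> D" "norm (g - f1) < d"
    using dense d closure_approachable[of f1 D] by (auto simp: dist_norm)
  have TK: "norm (adjoint_op T y) \<le> K" if "y \<in> \<Gamma>" for y
  proof -
    have "norm y * K \<le> 1 * K" using \<Gamma>1[OF that] K by (intro mult_right_mono) auto
    then show ?thesis using norm_adjoint_op_le[of T y] by (simp add: K_def)
  qed
  have "norm f1 \<le> K" unfolding f1_def using y1 V by (intro TK) auto
  then have gup: "norm g \<le> K + d" using norm_triangle_sub[of g f1] g(2) by linarith
  have glow: "K - 2 * d \<le> norm g"
    using norm_triangle_sub[of f1 g] g(2) f1 by (simp add: norm_minus_commute)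
  txt \<open>\<open>L (F\<^sup>* y)\<close> is the error in replacing \<open>T\<^sup>* F\<^sup>* y\<close> by the multiple \<open>y(F e)\<close> of \<open>g\<close>.\<close>
  define L where "L = (\<lambda>b. blinfun_apply b e *\<^sub>R g - adjoint_op T b)"
  have linL: "linear L"
    by (rule linearI) (auto simp: L_def adjoint_op_def blinfun.add_left blinfun.scaleR_left
        blinfun.diff_left algebra_simps intro!: blinfun_eqI)
  have Lbound: "norm (L b) \<le> (2 * K + d) * norm b" for b
  proof -
    have "norm (L b) \<le> \<bar>blinfun_apply b e\<bar> * norm g + norm (adjoint_op T b)"
      unfolding L_def using norm_triangle_ineq4[of "blinfun_apply b e *\<^sub>R g"] by simp
    also have "\<dots> \<le> norm b * (K + d) + norm b * K"
      using norm_blinfun[of b e] e gup norm_adjoint_op_le[of T b]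
      by (intro add_mono mult_mono) (auto simp: K_def)
    finally show ?thesis by (simp add: algebra_simps)
  qed
  \<comment> \<open>On \<open>V\<close>, \<open>d * (K + d)\<close> bounds
    \<open>\<bar>v(e) - 1\<bar> * norm g\<close>, and \<open>2 * d\<close> covers the steps from
    \<open>g\<close> to \<open>f1\<close> and from \<open>f1\<close> to
    \<open>adjoint_op T v\<close>.\<close>
  define \<kappa> where "\<kappa> = d * (K + d) + 2 * d"
  have "absolutely_convex hull ({0} \<union> V) \<subseteq> {a. norm (L a) \<le> \<kappa>}"
  proof (rule hull_minimal[where S = absolutely_convex])
    show "absolutely_convex {a. norm (L a) \<le> \<kappa>}" by (rule absolutely_convex_norm_le[OF linL])
    have "norm (L v) \<le> \<kappa>" if v: "v \<in> V" for v
    proof -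
      have "norm (f1 - adjoint_op T v) \<le> diameter (adjoint_op T ` (W \<inter> \<Gamma>))"
        unfolding dist_norm[symmetric] f1_def
        using v y1 V by (intro diameter_bounded_bound[OF bdd]) auto
      then have 1: "norm (f1 - adjoint_op T v) \<le> d" using diam by simp
      have 2: "norm ((blinfun_apply v e - 1) *\<^sub>R g) \<le> d * (K + d)"
        using Ve v gup d K by (auto intro!: mult_mono)
      have "L v = (blinfun_apply v e - 1) *\<^sub>R g + ((g - f1) + (f1 - adjoint_op T v))"
        by (simp add: L_def algebra_simps)
      then show ?thesis
        using 1 2 g(2) norm_triangle_ineq[of "(blinfun_apply v e - 1) *\<^sub>R g" "(g - f1) + (f1 - adjoint_op T v)"]
          norm_triangle_ineq[of "g - f1" "f1 - adjoint_op T v"]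
        by (simp add: \<kappa>_def)
    qed
    moreover have "0 \<le> \<kappa>" using d K by (simp add: \<kappa>_def)
    ultimately show "{0} \<union> V \<subseteq> {a. norm (L a) \<le> \<kappa>}"
      by (auto simp: linear_0[OF linL])
  qed
  then have hull: "norm (L a) \<le> \<kappa>" if "a \<in> absolutely_convex hull ({0} \<union> V)" for a
    using that by auto
  \<comment> \<open>Dominates \<open>\<kappa> + (2 * K + d) * d\<close>, using
    \<open>d * d \<le> d\<close>.\<close>
  define \<eta> where "\<eta> = d * (3 * K + 4)"
  have LF: "norm (L (adjoint_op F y)) \<le> \<eta>" if y: "y \<in> \<Gamma>" for y
  proof -
    let ?H = "absolutely_convex hull ({0} \<union> V)"
    \<comment> \<open>\<open>infdist\<close> to an empty set is 0 by default, so a near point exists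
      only once the hull is known to be nonempty.\<close>
    have "?H \<noteq> {}" using hull_subset[of "{0} \<union> V" absolutely_convex] by auto
    then obtain a where a: "a \<in> ?H" "dist (adjoint_op F y) a < d"
      using aco y by (auto simp: infdist_notempty dest!: cInf_lessD[rotated])
    have "norm (L (adjoint_op F y)) \<le> norm (L a) + norm (L (adjoint_op F y - a))"
      by (simp add: linear_diff[OF linL] norm_triangle_sub)
    also have "\<dots> \<le> \<kappa> + (2 * K + d) * d"
      by (rule add_mono[OF hull[OF a(1)] order_trans[OF Lbound mult_left_mono]])
        (use a(2) K d in \<open>auto simp: dist_norm\<close>)
    also have "\<dots> \<le> \<eta>"
      using mult_left_mono[of d 1 d] d d1 by (simp add: \<kappa>_def \<eta>_def algebra_simps)
    finally show ?thesis .
  qed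
  \<comment> \<open>The factor \<open>1 - \<epsilon>\<close> creates the slack for the bound by
    \<open>norm g\<close>; it moves the operator by at most
    \<open>2 * K * \<epsilon>\<close>.\<close>
  define S where "S = (blinfun_scaleR_left (blinfun_apply F e) o\<^sub>L g) + (1 - \<epsilon>) *\<^sub>R (T - (F o\<^sub>L T))"
  have S: "adjoint_op S y = blinfun_apply y (blinfun_apply F e) *\<^sub>R g
      + (1 - \<epsilon>) *\<^sub>R adjoint_op T (y - adjoint_op F y)" for y
    by (rule blinfun_eqI) (simp add: S_def adjoint_op_def blinfun.add_left blinfun.add_right
        blinfun.scaleR_left blinfun.scaleR_right blinfun.diff_left blinfun.diff_right)
  have Te: "norm (adjoint_op T (y - adjoint_op F y)) \<le> K * norm (y - adjoint_op F y)" for y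
    using norm_adjoint_op_le[of T] by (simp add: K_def mult.commute)
  have Fe: "blinfun_apply (adjoint_op F y) e = blinfun_apply y (blinfun_apply F e)" for y
    by (simp add: adjoint_op_def)
  have S1: "adjoint_op S y1 = g"
    using adjoint_op_diff[of T y1 y1] by (simp add: S y1F)
  have normS: "norm S \<le> norm g"
  proof (rule norm_blinfun_le_one_norming[OF \<Gamma>])
    fix y assume y: "y \<in> \<Gamma>"
    let ?r = "blinfun_apply y (blinfun_apply F e)"
    txt \<open>On \<open>V\<^sub>1\<close> the inequality of the ACK structure suffices. Off \<open>V\<^sub>1\<close> the functional \<open>S\<^sup>* y\<close> is
      within \<open>\<eta>\<close> of \<open>\<epsilon> r g + (1 - \<epsilon>) T\<^sup>* y\<close> with \<open>\<bar>r\<bar> \<le> \<rho> < 1\<close>, and the slack \<open>\<epsilon> (1 - \<rho>) K\<close> absorbs \<open>\<eta>\<close>.\<close>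
    show "norm (adjoint_op S y) \<le> norm g"
    proof (cases "norm (adjoint_op F y) + (1 - d) * norm (y - adjoint_op F y) \<le> 1")
      case True
      have "\<bar>?r\<bar> \<le> norm (adjoint_op F y)"
        using norm_blinfun[of "adjoint_op F y" e] e by (simp add: Fe)
      \<comment> \<open>Trades the weight \<open>1 - \<epsilon>\<close> on \<open>T\<close> for the
        weight \<open>1 - d\<close> on \<open>g\<close> that appears in the ACK inequality.\<close>
      moreover have "(1 - \<epsilon>) * K \<le> (1 - d) * norm g"
      proof -
        have eqs: "(1 - \<epsilon>) * K = K - K * \<epsilon>"
          "(1 - d) * (K - 2 * d) = K - 2 * d - d * K + 2 * (d * d)"
          by (simp_all add: algebra_simps)
        have "(1 - \<epsilon>) * K \<le> (1 - d) * (K - 2 * d)"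
          unfolding eqs using dexp dpos d mult_pos_pos[OF d d] by linarith
        also have "\<dots> \<le> (1 - d) * norm g" using glow d1 by (intro mult_left_mono) auto
        finally show ?thesis .
      qed
      moreover have "norm (adjoint_op S y)
          \<le> \<bar>?r\<bar> * norm g + (1 - \<epsilon>) * norm (adjoint_op T (y - adjoint_op F y))"
        unfolding S using \<epsilon> by (intro norm_triangle_le) simp
      moreover have "(1 - \<epsilon>) * norm (adjoint_op T (y - adjoint_op F y))
          \<le> (1 - \<epsilon>) * (K * norm (y - adjoint_op F y))"
        using Te \<epsilon> by (intro mult_left_mono) auto
      ultimately have "norm (adjoint_op S y)
          \<le> norm (adjoint_op F y) * norm g + (1 - d) * norm g * norm (y - adjoint_op F y)"
        using mult_right_mono[of "\<bar>?r\<bar>" "norm (adjoint_op F y)" "norm g"]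
          mult_right_mono[of "(1 - \<epsilon>) * K" "(1 - d) * norm g" "norm (y - adjoint_op F y)"]
        by (simp add: mult.assoc)
      also have "\<dots> = (norm (adjoint_op F y) + (1 - d) * norm (y - adjoint_op F y)) * norm g"
        by (simp add: algebra_simps)
      also have "\<dots> \<le> 1 * norm g" by (intro mult_right_mono True) auto
      finally show ?thesis by simp
    next
      case False
      then have r: "\<bar>?r\<bar> \<le> \<rho>" using V1 y by auto
      have "adjoint_op S y = (\<epsilon> * ?r) *\<^sub>R g
          + ((1 - \<epsilon>) *\<^sub>R adjoint_op T y + (1 - \<epsilon>) *\<^sub>R L (adjoint_op F y))"
        by (simp add: S L_def Fe adjoint_op_diff algebra_simps)
      also have "norm \<dots> \<le> \<epsilon> * \<rho> * norm g + ((1 - \<epsilon>) * K + 1 * \<eta>)"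
      proof (intro norm_triangle_mono)
        show "norm ((\<epsilon> * ?r) *\<^sub>R g) \<le> \<epsilon> * \<rho> * norm g"
          using r \<epsilon> by (auto simp: abs_mult intro!: mult_mono)
        show "norm ((1 - \<epsilon>) *\<^sub>R adjoint_op T y) \<le> (1 - \<epsilon>) * K"
          using \<epsilon> TK[OF y] by (auto intro!: mult_left_mono)
        show "norm ((1 - \<epsilon>) *\<^sub>R L (adjoint_op F y)) \<le> 1 * \<eta>"
          unfolding norm_scaleR using \<epsilon> LF[OF y] by (intro mult_mono) auto
      qed
      also have "\<dots> \<le> norm g"
      proof -
        have \<epsilon>\<rho>: "\<epsilon> * \<rho> \<le> 1" "0 \<le> \<epsilon> * \<rho>" using \<epsilon> \<rho> by (auto intro: mult_le_one)
        have "(1 - \<epsilon>) * K + \<eta> \<le> (1 - \<epsilon> * \<rho>) * K - 2 * d"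
          using dK by (simp add: \<eta>_def algebra_simps)
        also have "\<dots> \<le> (1 - \<epsilon> * \<rho>) * K - 2 * d + 2 * (\<epsilon> * \<rho> * d)"
          using mult_nonneg_nonneg[OF \<epsilon>\<rho>(2), of d] d by simp
        also have "\<dots> = (1 - \<epsilon> * \<rho>) * (K - 2 * d)" by (simp add: algebra_simps)
        also have "\<dots> \<le> (1 - \<epsilon> * \<rho>) * norm g" using glow \<epsilon>\<rho> by (intro mult_left_mono) auto
        finally show ?thesis by (simp add: algebra_simps)
      qed
      finally show ?thesis .
    qed
  qed simp
  have "norm (S - T) \<le> 3 * K * \<epsilon>"
  proof (rule norm_blinfun_le_one_norming[OF \<Gamma>])
    fix y assume y: "y \<in> \<Gamma>"
    have "adjoint_op (S - T) y = adjoint_op S y - adjoint_op T y"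
      by (rule blinfun_eqI) (simp add: adjoint_op_def blinfun.diff_left blinfun.diff_right)
    also have "\<dots> = L (adjoint_op F y) - \<epsilon> *\<^sub>R adjoint_op T (y - adjoint_op F y)"
      by (simp add: S L_def Fe adjoint_op_diff algebra_simps)
    also have "norm \<dots> \<le> \<eta> + \<epsilon> * (K * 2)"
    proof (rule order_trans[OF norm_triangle_ineq4 add_mono])
      have "norm (adjoint_op F y) \<le> norm y" using norm_adjoint_op_le[of F y] F by simp
      then have "norm (y - adjoint_op F y) \<le> 2"
        using norm_triangle_ineq4[of y "adjoint_op F y"] \<Gamma>1[OF y] by simp
      then have "K * norm (y - adjoint_op F y) \<le> K * 2" using K by simp
      then show "norm (\<epsilon> *\<^sub>R adjoint_op T (y - adjoint_op F y)) \<le> \<epsilon> * (K * 2)"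
        using \<epsilon> order_trans[OF Te] by (auto intro!: mult_left_mono)
    qed (rule LF[OF y])
    \<comment> \<open>By \<open>dexp\<close> the part from \<open>\<eta>\<close> is at most
      \<open>K * \<epsilon>\<close>, whence the constant 3.\<close>
    also have "\<dots> = 3 * (d * K) + 4 * d + 2 * (K * \<epsilon>)" by (simp add: \<eta>_def algebra_simps)
    also have "\<dots> \<le> 3 * K * \<epsilon>" using dexp d by simp
    finally show "norm (adjoint_op (S - T) y) \<le> 3 * K * \<epsilon>" .
  qed (use K \<epsilon> in simp)
  then show ?thesis
    using S1 g(1) normS \<Gamma>1[of y1] y1 V by (intro exI[of _ S] exI[of _ y1]) (auto simp: K_def)
qed

section \<open>Transfer to Lipschitz maps\<close>

lemma linearization_diff:
  "linearization (F - G) = linearization F - linearization G"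
  by (rule linear_diff[OF linear_linearization])

lemma dist_linearization: "dist (linearization F) (linearization G) = dist F G"
  by (simp add: dist_norm linearization_diff[symmetric] norm_linearization)

lemma closure_linearization_image:
  fixes A :: "('a::pointed_complete_space, 'b::banach) lip0 set"
  shows "closure (linearization ` A) = linearization ` closure A"
proof (rule set_eqI)
  fix T :: "'a lip_free \<Rightarrow>\<^sub>L 'b"
  obtain F where F: "T = linearization F" using bij_linearization by (metis bij_pointE)
  show "T \<in> closure (linearization ` A) \<longleftrightarrow> T \<in> linearization ` closure A"
    unfolding F inj_image_mem_iff[OF bij_is_inj[OF bij_linearization]]
    by (simp add: closure_approachable dist_linearization)
qed

lemma adjoint_op_linearization: "adjoint_op (linearization F) y = linearization (lip0_compose y F)"
  by (rule sym, rule linearization_eqI) (simp add: adjoint_op_def lip0_compose.rep_eq)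

text \<open>Since \<open>norm y \<le> 1\<close>, the slope of \<open>F\<close> at a pair dominates
  that of its composition with \<open>y\<close>; where the latter reaches its norm, the former
  reaches \<open>norm F\<close>.\<close>

lemma LipSNA_of_functional:
  fixes F :: "('a::pointed_complete_space, 'b::banach) lip0"
  assumes y: "norm y \<le> 1" and sna: "lip0_compose y F \<in> LipSNA"
    and le: "norm F \<le> norm (lip0_compose y F)"
  shows "F \<in> LipSNA"
proof -
  obtain p q where pq: "p \<noteq> q" and at: "\<bar>blinfun_apply y (lip0_apply F p - lip0_apply F q)\<bar> / dist p q
      = norm (lip0_compose y F)"
    using sna by (auto simp: LipSNA_def lip0_compose.rep_eq blinfun.diff_right)
  have "\<bar>blinfun_apply y (lip0_apply F p - lip0_apply F q)\<bar>
      \<le> norm y * norm (lip0_apply F p - lip0_apply F q)"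
    using norm_blinfun[of y] by simp
  also have "\<dots> \<le> norm (lip0_apply F p - lip0_apply F q)"
    using y by (simp add: mult_left_le_one_le)
  finally have "norm F \<le> norm (lip0_apply F p - lip0_apply F q) / dist p q"
    using le at divide_right_mono[OF _ zero_le_dist[of p q]] by fastforce
  moreover have "norm (lip0_apply F p - lip0_apply F q) / dist p q \<le> norm F"
    using lip0_lipschitz[of F p q] pq by (simp add: divide_le_eq)
  ultimately show ?thesis using pq by (auto simp: LipSNA_def)
qed

theorem theorem3p10:
  fixes \<Gamma> :: "('b::banach \<Rightarrow>\<^sub>L real) set" and \<rho> :: real
  assumes "closure (LipSNA :: ('a::pointed_complete_space, real) lip0 set) = UNIV"
    and "0 \<le> \<rho>" and "\<rho> < 1"
    and "ACK_structure \<rho> \<Gamma>"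
  shows "(flat_operators \<Gamma> :: ('a lip_free \<Rightarrow>\<^sub>L 'b) set)
           \<subseteq> linearization ` closure (LipSNA :: ('a, 'b) lip0 set)"
proof
  fix T :: "'a lip_free \<Rightarrow>\<^sub>L 'b"
  assume flat: "T \<in> flat_operators \<Gamma>"
  show "T \<in> linearization ` closure (LipSNA :: ('a, 'b) lip0 set)"
  proof (cases "T = 0")
    case True
    \<comment> \<open>On a one-point space \<open>LipSNA\<close> is empty and not dense. Density
      thus yields two distinct points, at which the zero map attains its norm.\<close>
    have "(LipSNA :: ('a, real) lip0 set) \<noteq> {}" using assms(1) by auto
    then obtain p q :: 'a where "p \<noteq> q" by (auto simp: LipSNA_def)
    then have "(0 :: ('a, 'b) lip0) \<in> LipSNA"
      by (auto simp: LipSNA_def zero_lip0.rep_eq)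
    moreover have "T = linearization 0" by (simp add: True linear_0[OF linear_linearization])
    ultimately show ?thesis using closure_subset by blast
  next
    case False
    let ?D = "linearization ` (LipSNA :: ('a, real) lip0 set)"
    have dense: "closure ?D = UNIV"
      by (simp add: closure_linearization_image assms(1) bij_is_surj[OF bij_linearization])
    have "T \<in> closure (linearization ` (LipSNA :: ('a, 'b) lip0 set))"
      unfolding closure_approachable
    proof (intro allI impI)
      fix r :: real assume r: "r > 0"
      \<comment> \<open>Using 4 in place of 3 makes the final estimate strict.\<close>
      define \<epsilon> where "\<epsilon> = min 1 (r / (4 * norm T))"
      have \<epsilon>: "0 < \<epsilon>" "\<epsilon> \<le> 1" using r False by (auto simp: \<epsilon>_def)
      have "\<epsilon> \<le> r / (4 * norm T)" by (simp add: \<epsilon>_def)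
      then have small: "3 * norm T * \<epsilon> < r"
        using False r by (simp add: field_simps)
      obtain S y where S: "norm (S - T) \<le> 3 * norm T * \<epsilon>" "norm y \<le> 1" "adjoint_op S y \<in> ?D"
        "norm S \<le> norm (adjoint_op S y)"
        using flat_operator_approximation[OF assms(4,2,3) flat False dense \<epsilon>] by blast
      obtain G where G: "S = linearization G" using bij_linearization by (metis bij_pointE)
      have "G \<in> LipSNA"
        using S unfolding G adjoint_op_linearization norm_linearization
        by (intro LipSNA_of_functional[of y])
          (auto simp: inj_image_mem_iff[OF bij_is_inj[OF bij_linearization]])
      moreover have "dist S T < r" using S(1) small by (simp add: dist_norm)
      ultimately show "\<exists>S\<in>linearization ` LipSNA. dist S T < r" using G by blast
    qed
    then show ?thesis by (simp add: closure_linearization_image)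
  qed
qed

end
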